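(* Let $d$, $n$, $k$ be positive integers with $d\mid n$, let $s\ge0$ be an integer, and let $\zeta\in\mathbb{C}$ be a primitive $d$-th root of unity. Let $T$ be an endofunction on $[n]=\{1,\dots,n\}$ with one connected component, consisting of a cycle having $ds+1$ nodes and $k$ trees $T_1,\dots,T_k$ attached to the nodes of the cycle, such that each of the $k-1$ trees $T_1,\dots,T_{k-1}$ has a $d$-splitting subset, and $T_k$ together with its root node on the cycle has a $d$-splitting subset. Then $$\sigma(d;T)=g_T(\zeta,\zeta^2,\dots,\zeta^d).$$
   Context: A connected endofunction $T$ of a finite set (one whose functional graph with edges $x\to T(x)$ is connected) has exactly one cycle. For each node $v$ not on the cycle with $T(v)$ on the cycle, the tree attached to the cycle with root $v$ consists of all nodes $x$ with $T^i(x)=v$ for some $i\ge0$; it does not include the cycle node $T(v)$. "The attached tree together with its root node on the cycle" is the rooted tree obtained by adding the cycle node $c=T(v)$ and the edge $v\to c$, with new root $c$. Any rooted tree (edges pointing to the root) is regarded as an endofunction of its node set by sending each non-root node along its outgoing edge and the root to itself. For an endofunction $S$ on a finite set $X$ of size $M$, a subset $W\subseteq X$ is $d$-splitting if $d\mid M$, $|W|=M/d$ and $W\cup SW\cup\cdots\cup S^{d-1}W=X$; $\sigma(d;S)$ is the number of $d$-splitting subsets. A tree has a $d$-splitting subset if the associated endofunction does. A subset $U$ is $T$-invariant if $TU\subseteq U$. A $d$-flag of $T$-invariant subsets of $[n]$ is a sequence $\emptyset=U_0\subseteq U_1\subseteq\cdots\subseteq U_{d-1}\subseteq U_d=[n]$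 with every $U_i$ $T$-invariant. The generating function of $d$-flags is $g_T(t_1,\dots,t_d)=\sum_J a_J\,t_1^{j_1}\cdots t_d^{j_d}$, the sum over $d$-tuples $J=(j_1,\dots,j_d)$ of non-negative integers, where $a_J$ is the number of $d$-flags with $|U_i|=j_1+\cdots+j_i$ for all $1\le i\le d$. *)

theory Defs
  imports Complex_Main "HOL-Library.FuncSet"
begin

definition primitive_root_of_unity :: "nat \<Rightarrow> 'a::comm_ring_1 \<Rightarrow> bool" where
  "primitive_root_of_unity d z \<longleftrightarrow> d > 0 \<and> z ^ d = 1 \<and> (\<forall>m. 0 < m \<and> m < d \<longrightarrow> z ^ m \<noteq> 1)"

text \<open>Throughout, an endofunction of a finite set \<open>X\<close> is a function \<open>T\<close> with
  \<open>T \<in> X \<rightarrow> X\<close>; the values of \<open>T\<close> outside \<open>X\<close> play no role.\<close>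

definition functional_graph :: "'a set \<Rightarrow> ('a \<Rightarrow> 'a) \<Rightarrow> ('a \<times> 'a) set" where
  "functional_graph X T = {(x, T x) | x. x \<in> X}"

text \<open>Connected means connected as an undirected graph.\<close>

definition connected_endo :: "'a set \<Rightarrow> ('a \<Rightarrow> 'a) \<Rightarrow> bool" where
  "connected_endo X T \<longleftrightarrow>
     (\<forall>x\<in>X. \<forall>y\<in>X. (x, y) \<in> (functional_graph X T \<union> (functional_graph X T)\<inverse>)\<^sup>*)"

definition cycle_nodes :: "'a set \<Rightarrow> ('a \<Rightarrow> 'a) \<Rightarrow> 'a set" where
  "cycle_nodes X T = {x \<in> X. \<exists>i>0. (T ^^ i) x = x}"

text \<open>An attached tree is determined by its root: a node off the cycle whose image
  is on the cycle. Several attached trees may share the same cycle node.\<close>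

definition attached_roots :: "'a set \<Rightarrow> ('a \<Rightarrow> 'a) \<Rightarrow> 'a set" where
  "attached_roots X T = {v \<in> X. v \<notin> cycle_nodes X T \<and> T v \<in> cycle_nodes X T}"

definition attached_tree :: "'a set \<Rightarrow> ('a \<Rightarrow> 'a) \<Rightarrow> 'a \<Rightarrow> 'a set" where
  "attached_tree X T v = {x \<in> X. \<exists>i. (T ^^ i) x = v}"

text \<open>The endofunction of a rooted tree with root \<open>r\<close> in which every other node \<open>x\<close>
  has the outgoing edge from \<open>x\<close> to \<open>T x\<close>.\<close>

definition tree_endo :: "('a \<Rightarrow> 'a) \<Rightarrow> 'a \<Rightarrow> 'a \<Rightarrow> 'a" where
  "tree_endo T r x = (if x = r then r else T x)"

definition splitting :: "nat \<Rightarrow> 'a set \<Rightarrow> ('a \<Rightarrow> 'a) \<Rightarrow> 'a set \<Rightarrow> bool" where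
  "splitting d X S W \<longleftrightarrow>
     W \<subseteq> X \<and> d dvd card X \<and> card W = card X div d \<and> (\<Union>i<d. (S ^^ i) ` W) = X"

definition \<sigma> :: "nat \<Rightarrow> 'a set \<Rightarrow> ('a \<Rightarrow> 'a) \<Rightarrow> nat" where
  "\<sigma> d X S = card {W. splitting d X S W}"

definition tree_has_splitting :: "nat \<Rightarrow> 'a set \<Rightarrow> ('a \<Rightarrow> 'a) \<Rightarrow> 'a \<Rightarrow> bool" where
  "tree_has_splitting d N T r \<longleftrightarrow> (\<exists>W. splitting d N (tree_endo T r) W)"

definition invariant_subset :: "'a set \<Rightarrow> ('a \<Rightarrow> 'a) \<Rightarrow> 'a set \<Rightarrow> bool" where
  "invariant_subset X T U \<longleftrightarrow> U \<subseteq> X \<and> T ` U \<subseteq> U"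

definition flags :: "nat \<Rightarrow> 'a set \<Rightarrow> ('a \<Rightarrow> 'a) \<Rightarrow> (nat \<Rightarrow> 'a set) set" where
  "flags d X T = {U \<in> {0..d} \<rightarrow>\<^sub>E {V. invariant_subset X T V}.
     U 0 = {} \<and> U d = X \<and> (\<forall>i<d. U i \<subseteq> U (Suc i))}"

definition flag_count :: "nat \<Rightarrow> 'a set \<Rightarrow> ('a \<Rightarrow> 'a) \<Rightarrow> (nat \<Rightarrow> nat) \<Rightarrow> nat" where
  "flag_count d X T J = card {U \<in> flags d X T. \<forall>i\<in>{1..d}. card (U i) = (\<Sum>l=1..i. J l)}"

text \<open>The generating function of flags, evaluated at the point with coordinates
  \<open>t 1, \<dots>, t d\<close>. Only finitely many \<open>d\<close>-tuples \<open>J\<close> have a nonzero coefficient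
  (see \<open>finite_flag_support\<close> below), so the sum over all \<open>J\<close> is the sum over
  this support.\<close>

definition flag_gf :: "nat \<Rightarrow> 'a set \<Rightarrow> ('a \<Rightarrow> 'a) \<Rightarrow> (nat \<Rightarrow> 'b::comm_semiring_1) \<Rightarrow> 'b" where
  "flag_gf d X T t =
     (\<Sum>J\<in>{J \<in> {1..d} \<rightarrow>\<^sub>E UNIV. flag_count d X T J \<noteq> 0}.
        of_nat (flag_count d X T J) * (\<Prod>i=1..d. t i ^ J i))"

lemma finite_flag_support:
  assumes "finite X"
  shows "finite {J \<in> {1..d} \<rightarrow>\<^sub>E UNIV. flag_count d X T J \<noteq> 0}"
proof (rule finite_subset)
  show "{J \<in> {1..d} \<rightarrow>\<^sub>E UNIV. flag_count d X T J \<noteq> 0} \<subseteq> {1..d} \<rightarrow>\<^sub>E {0..card X}"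
  proof
    fix J assume "J \<in> {J \<in> {1..d} \<rightarrow>\<^sub>E (UNIV :: nat set). flag_count d X T J \<noteq> 0}"
    then have J: "J \<in> {1..d} \<rightarrow>\<^sub>E UNIV" and "flag_count d X T J \<noteq> 0" by auto
    then obtain U where U: "U \<in> flags d X T" "\<forall>i\<in>{1..d}. card (U i) = (\<Sum>l=1..i. J l)"
      unfolding flag_count_def by (metis (mono_tags, lifting) Collect_empty_eq card.empty)
    have "J i \<le> card X" if "i \<in> {1..d}" for i
    proof -
      have "J i \<le> (\<Sum>l=1..i. J l)" using that by (intro member_le_sum) auto
      also have "\<dots> = card (U i)" using U(2) that by simp
      also have "\<dots> \<le> card X"
        using U(1) that assms by (intro card_mono) (auto simp: flags_def invariant_subset_def PiE_iff)
      finally show ?thesis .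
    qed
    with J show "J \<in> {1..d} \<rightarrow>\<^sub>E {0..card X}" by (auto simp: PiE_iff)
  qed
qed (simp add: finite_PiE)

end

(* Recording for every node the index of the first member of a flag that contains it turns flags
   into labelings f with f (T x) <= f x, so the right-hand side is the sum of zeta^(sum of labels)
   over these labelings. A splitting subset is the set of starting points of a partition of the
   graph into directed paths with d nodes each. For j in {1..d}, the labelings of such a path with
   all labels >= j have weighted sum h_d(zeta^j, ..., zeta^d) = 1, so a path that no outside
   node enters can be removed without changing the label sum. This removes T_1, ..., T_{k-1}. As
   zeta^(d s + 1) = zeta, the cycle may then be contracted to the root of T_k, and what remains is
   a tree partitioned into paths, so the sum is 1. The splitting subset is unique as well: starting
   from the leaves, every path is forced. *)

theory Submission
  imports Defs "HOL-Library.Disjoint_Sets"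
begin

section \<open>Flags as labelings\<close>

definition labelings :: "nat \<Rightarrow> 'a set \<Rightarrow> ('a \<Rightarrow> 'a) \<Rightarrow> ('a \<Rightarrow> nat) set" where
  "labelings d X T = {f \<in> X \<rightarrow>\<^sub>E {1..d}. \<forall>x\<in>X. f (T x) \<le> f x}"

lemma finite_labelings: "finite X \<Longrightarrow> finite (labelings d X T)"
  unfolding labelings_def by (rule finite_subset[of _ "X \<rightarrow>\<^sub>E {1..d}"]) (auto intro: finite_PiE)

lemma labelings_range: "f \<in> labelings d X T \<Longrightarrow> x \<in> X \<Longrightarrow> f x \<in> {1..d}"
  unfolding labelings_def by blast

lemma labelings_le: "f \<in> labelings d X T \<Longrightarrow> x \<in> X \<Longrightarrow> f (T x) \<le> f x"
  by (auto simp: labelings_def)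

definition sublevel_flag :: "nat \<Rightarrow> 'a set \<Rightarrow> ('a \<Rightarrow> nat) \<Rightarrow> nat \<Rightarrow> 'a set" where
  "sublevel_flag d X f = (\<lambda>i\<in>{0..d}. {x \<in> X. f x \<le> i})"

lemma flags_mono:
  assumes "U \<in> flags d X T" "i \<le> j" "j \<le> d"
  shows "U i \<subseteq> U j"
  using assms(2,3)
proof (induction rule: dec_induct)
  case (step m)
  then have "U m \<subseteq> U (Suc m)" using assms(1) by (auto simp: flags_def)
  then show ?case using step by auto
qed auto

text \<open>The inverse sends a flag to the index of the first member that contains a given node.
  Invariance of all sublevel sets amounts to \<open>f (T x) \<le> f x\<close>, and the conditions on
  \<open>U 0\<close> and \<open>U d\<close> amount to labels in \<open>{1..d}\<close>.\<close>

lemma bij_betw_sublevel_flag: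
  assumes T: "T \<in> X \<rightarrow> X"
  shows "bij_betw (sublevel_flag d X) (labelings d X T) (flags d X T)"
  unfolding bij_betw_def
proof
  show "inj_on (sublevel_flag d X) (labelings d X T)"
  proof (rule inj_onI)
    fix f g assume f: "f \<in> labelings d X T" and g: "g \<in> labelings d X T"
      and eq: "sublevel_flag d X f = sublevel_flag d X g"
    have level: "{x \<in> X. f x \<le> i} = {x \<in> X. g x \<le> i}" if "i \<le> d" for i
      using fun_cong[OF eq, of i] that by (simp add: sublevel_flag_def)
    have "f x = g x" if x: "x \<in> X" for x
    proof (rule antisym)
      show "f x \<le> g x" using level[of "g x"] labelings_range[OF g x] x by auto
      show "g x \<le> f x" using level[of "f x"] labelings_range[OF f x] x by auto
    qed
    then show "f = g" using f g unfolding labelings_def by (blast intro: PiE_ext)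
  qed
  show "sublevel_flag d X ` labelings d X T = flags d X T"
  proof (intro equalityI subsetI)
    fix U assume "U \<in> sublevel_flag d X ` labelings d X T"
    then obtain f where f: "f \<in> labelings d X T" and U: "U = sublevel_flag d X f" by blast
    have "invariant_subset X T {x \<in> X. f x \<le> i}" for i
      unfolding invariant_subset_def using T labelings_le[OF f] by (fastforce intro: order_trans)
    moreover have "{x \<in> X. f x \<le> 0} = {}" "{x \<in> X. f x \<le> d} = X"
      using labelings_range[OF f] by fastforce+
    ultimately show "U \<in> flags d X T"
      unfolding U flags_def sublevel_flag_def by auto
  next
    fix U assume U: "U \<in> flags d X T"
    define f where "f = (\<lambda>x\<in>X. LEAST i. x \<in> U i)"
    have U0: "U 0 = {}" and Ud: "U d = X" and inv: "\<And>i. i \<le> d \<Longrightarrow> invariant_subset X T (U i)"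
      using U by (auto simp: flags_def PiE_iff)
    have mem: "x \<in> U (f x)" and le: "f x \<le> d" and pos: "f x \<ge> 1" if "x \<in> X" for x
    proof -
      have *: "x \<in> U d" using that Ud by simp
      show m: "x \<in> U (f x)" using that LeastI[of "\<lambda>i. x \<in> U i", OF *] by (simp add: f_def)
      show "f x \<le> d" using that Least_le[of "\<lambda>i. x \<in> U i", OF *] by (simp add: f_def)
      show "f x \<ge> 1" using m U0 by (cases "f x") auto
    qed
    have least: "f x \<le> i" if "x \<in> X" "x \<in> U i" for x i
      using that by (auto simp: f_def intro: Least_le)
    have "f \<in> labelings d X T"
      unfolding labelings_def
    proof (intro CollectI conjI ballI)
      show "f \<in> X \<rightarrow>\<^sub>E {1..d}" using le pos by (auto simp: f_def)
      fix x assume x: "x \<in> X"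
      then have "T x \<in> U (f x)" using mem le inv unfolding invariant_subset_def by blast
      then show "f (T x) \<le> f x" using x T by (intro least) auto
    qed
    moreover have "U = sublevel_flag d X f"
    proof
      fix i
      show "U i = sublevel_flag d X f i"
      proof (cases "i \<le> d")
        case True
        have "U i = {x \<in> X. f x \<le> i}"
          using True inv[OF True] mem flags_mono[OF U _ True] least
          unfolding invariant_subset_def by blast
        then show ?thesis using True by (simp add: sublevel_flag_def)
      next
        case False
        then show ?thesis using U by (auto simp: flags_def sublevel_flag_def PiE_iff extensional_def)
      qed
    qed
    ultimately show "U \<in> sublevel_flag d X ` labelings d X T" by blast
  qed
qed

text \<open>\<open>flag_count\<close> prescribes the cumulative sizes of the \<open>U i\<close>,
  while the weight of a labeling is made of the sizes of single level sets; differences of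
  consecutive sums mediate.\<close>

lemma partial_sums_eq_iff:
  fixes a b :: "nat \<Rightarrow> nat"
  shows "(\<forall>i\<in>{1..d}. (\<Sum>l=1..i. a l) = (\<Sum>l=1..i. b l)) \<longleftrightarrow> (\<forall>i\<in>{1..d}. a i = b i)"
proof
  assume L: "\<forall>i\<in>{1..d}. (\<Sum>l=1..i. a l) = (\<Sum>l=1..i. b l)"
  show "\<forall>i\<in>{1..d}. a i = b i"
  proof
    fix i assume i: "i \<in> {1..d}"
    then obtain j where j: "i = Suc j" by (cases i) auto
    have "(\<Sum>l=1..j. a l) = (\<Sum>l=1..j. b l)" using L i j by (cases "j = 0") (auto simp del: sum.cl_ivl_Suc)
    moreover have "(\<Sum>l=1..Suc j. a l) = (\<Sum>l=1..Suc j. b l)" using L i j by blast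
    ultimately show "a i = b i" using j by simp
  qed
qed (auto intro!: sum.cong)

text \<open>The product over \<open>X\<close> depends only on how often each label occurs. Grouping
  the labelings by these numbers gives one monomial for each \<open>J\<close>, with coefficient
  \<open>flag_count d X T J\<close>.\<close>

lemma flag_gf_eq_sum_labelings:
  fixes t :: "nat \<Rightarrow> 'b::comm_semiring_1"
  assumes X: "finite X" and T: "T \<in> X \<rightarrow> X"
  shows "flag_gf d X T t = (\<Sum>f\<in>labelings d X T. \<Prod>x\<in>X. t (f x))"
proof -
  let ?L = "labelings d X T"
  \<comment> \<open>The exponent vector of a labeling, extensional so that it can equal an index
    \<open>J\<close> of the generating function.\<close>
  define cnt where "cnt f = (\<lambda>i\<in>{1..d}. card {x \<in> X. f x = i})" for f :: "'a \<Rightarrow> nat"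
  have cnt_iff: "(\<forall>i\<in>{1..d}. card {x \<in> X. f x \<le> i} = (\<Sum>l=1..i. J l)) \<longleftrightarrow> cnt f = J"
    if f: "f \<in> ?L" and J: "J \<in> {1..d} \<rightarrow>\<^sub>E UNIV" for f J
  proof -
    have "card {x \<in> X. f x \<le> i} = (\<Sum>l=1..i. card {x \<in> X. f x = l})" for i
    proof -
      have "{x \<in> X. f x \<le> i} = (\<Union>l\<in>{1..i}. {x \<in> X. f x = l})"
        using labelings_range[OF f] by fastforce
      then show ?thesis using X by (simp add: card_UN_disjoint disjoint_iff)
    qed
    moreover have "cnt f = J \<longleftrightarrow> (\<forall>i\<in>{1..d}. card {x \<in> X. f x = i} = J i)"
      using J by (auto simp: cnt_def PiE_iff extensional_def fun_eq_iff)
    ultimately show ?thesis by (simp only: partial_sums_eq_iff)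
  qed
  have count: "flag_count d X T J = card {f \<in> ?L. cnt f = J}" if J: "J \<in> {1..d} \<rightarrow>\<^sub>E UNIV" for J
  proof -
    have "bij_betw (sublevel_flag d X) {f \<in> ?L. cnt f = J}
        {U \<in> flags d X T. \<forall>i\<in>{1..d}. card (U i) = (\<Sum>l=1..i. J l)}"
    proof (rule bij_betw_imageI)
      show "inj_on (sublevel_flag d X) {f \<in> ?L. cnt f = J}"
        using bij_betw_sublevel_flag[OF T, of d] by (auto simp: bij_betw_def intro: inj_on_subset)
      have "(\<forall>i\<in>{1..d}. card (sublevel_flag d X f i) = (\<Sum>l=1..i. J l)) \<longleftrightarrow> cnt f = J"
        if "f \<in> ?L" for f
        using cnt_iff[OF that J] by (simp add: sublevel_flag_def)
      then show "sublevel_flag d X ` {f \<in> ?L. cnt f = J} =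
          {U \<in> flags d X T. \<forall>i\<in>{1..d}. card (U i) = (\<Sum>l=1..i. J l)}"
        unfolding bij_betw_imp_surj_on[OF bij_betw_sublevel_flag[OF T], symmetric] by blast
    qed
    then show ?thesis unfolding flag_count_def by (simp add: bij_betw_same_card)
  qed
  have prod: "(\<Prod>i=1..d. t i ^ cnt f i) = (\<Prod>x\<in>X. t (f x))" if f: "f \<in> ?L" for f
  proof -
    have "(\<Prod>x\<in>X. t (f x)) = (\<Prod>i=1..d. \<Prod>x\<in>{x \<in> X. f x = i}. t (f x))"
      using X labelings_range[OF f] by (intro prod.group[symmetric]) auto
    also have "\<dots> = (\<Prod>i=1..d. t i ^ cnt f i)"
      by (intro prod.cong) (auto simp: cnt_def)
    finally show ?thesis by simp
  qed
  let ?S = "{J \<in> {1..d} \<rightarrow>\<^sub>E UNIV. flag_count d X T J \<noteq> 0}"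
  have sub: "cnt ` ?L \<subseteq> ?S"
  proof (rule image_subsetI)
    fix f assume f: "f \<in> ?L"
    have "cnt f \<in> {1..d} \<rightarrow>\<^sub>E UNIV" by (simp add: cnt_def)
    moreover from this have "flag_count d X T (cnt f) \<noteq> 0"
      using f finite_labelings[OF X] by (auto simp: count)
    ultimately show "cnt f \<in> ?S" by blast
  qed
  have "flag_gf d X T t = (\<Sum>J\<in>?S. \<Sum>f\<in>{f \<in> ?L. cnt f = J}. \<Prod>x\<in>X. t (f x))"
    unfolding flag_gf_def
  proof (rule sum.cong)
    fix J assume J: "J \<in> ?S"
    have "(\<Sum>f\<in>{f \<in> ?L. cnt f = J}. \<Prod>x\<in>X. t (f x)) = (\<Sum>f\<in>{f \<in> ?L. cnt f = J}. \<Prod>i=1..d. t i ^ J i)"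
      by (rule sum.cong) (auto simp: prod[symmetric])
    then show "of_nat (flag_count d X T J) * (\<Prod>i=1..d. t i ^ J i) =
        (\<Sum>f\<in>{f \<in> ?L. cnt f = J}. \<Prod>x\<in>X. t (f x))"
      using J by (simp add: count)
  qed simp
  also have "\<dots> = (\<Sum>f\<in>?L. \<Prod>x\<in>X. t (f x))"
    using X sub by (intro sum.group finite_labelings finite_flag_support)
  finally show ?thesis .
qed

section \<open>Path weights at a root of unity\<close>

text \<open>This is the complete homogeneous symmetric polynomial \<open>h_m(z^j, \<dots>, z^d)\<close>, the weight of
  all weakly decreasing labelings of a path with \<open>m\<close> nodes by labels in \<open>{j..d}\<close>. The closed form
  below is its q-binomial evaluation at a root of unity.\<close>

primrec path_sum :: "'b::comm_semiring_1 \<Rightarrow> nat \<Rightarrow> nat \<Rightarrow> nat \<Rightarrow> 'b" where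
  "path_sum z d 0 j = 1"
| "path_sum z d (Suc m) j = (\<Sum>i=j..d. z ^ i * path_sum z d m i)"

text \<open>Splitting off the labelings in which \<open>j\<close> occurs gives \<open>h_(m+1)(z^j,
  ..., z^d) = z^j h_m(z^j, ..., z^d) + h_(m+1)(z^(j+1), ..., z^d)\<close>, and the product obeys the
  same recursion. \<open>m < d\<close> keeps the denominators nonzero; \<open>j = Suc d\<close> is
  the base of the downward induction.\<close>

lemma path_sum_closed_form:
  fixes z :: "'b::field"
  assumes z: "primitive_root_of_unity d z" and "m < d" "j \<in> {1..Suc d}"
  shows "path_sum z d m j = (\<Prod>l=1..m. (z ^ j - z ^ l) / (1 - z ^ l))"
  using assms(2,3)
proof (induction m arbitrary: j)
  case (Suc m)
  note IH = Suc.IH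
  \<comment> \<open>\<open>z ^ j\<close> becomes a free \<open>x\<close>, so that passing from
    \<open>j\<close> to \<open>Suc j\<close> multiplies \<open>x\<close> by
    \<open>z\<close>.\<close>
  define A where "A m x = (\<Prod>l=1..m. (x - z ^ l) / (1 - z ^ l))" for m x
  have nz: "1 - z ^ l \<noteq> 0" if "0 < l" "l < d" for l
    using z that by (auto simp: primitive_root_of_unity_def)
  have shift: "A (Suc m) x = A (Suc m) (z * x) + x * A m x" for x
  proof -
    \<comment> \<open>Pulling \<open>z\<close> out of each factor shifts the index by one, so that
      \<open>A (Suc m) (z * x)\<close> and \<open>A (Suc m) x\<close> share the factors of
      \<open>A m x\<close>.\<close>
    have "(\<Prod>l=1..Suc m. z * x - z ^ l) = (\<Prod>l=1..Suc m. z * (x - z ^ (l - 1)))"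
      by (rule prod.cong) (auto simp: algebra_simps power_eq_if)
    also have "\<dots> = z ^ Suc m * (\<Prod>l=0..m. x - z ^ l)"
      by (simp add: prod.distrib prod.atLeast_Suc_atMost_Suc_shift del: prod.cl_ivl_Suc)
    also have "(\<Prod>l=0..m. x - z ^ l) = (x - 1) * (\<Prod>l=1..m. x - z ^ l)"
      by (simp add: prod.atLeast_Suc_atMost)
    finally have "A (Suc m) (z * x) = z ^ Suc m * (x - 1) * A m x / (1 - z ^ Suc m)"
      by (simp add: A_def prod_dividef)
    moreover have "A (Suc m) x = A m x * (x - z ^ Suc m) / (1 - z ^ Suc m)"
      by (simp add: A_def)
    moreover have "a * (x - q) / (1 - q) = q * (x - 1) * a / (1 - q) + x * a" if "1 - q \<noteq> 0" for a q
      using that by (simp add: field_simps)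
    ultimately show ?thesis
      using nz[of "Suc m"] Suc.prems by (simp only:) simp
  qed
  have zd: "z ^ d = 1" using z by (simp add: primitive_root_of_unity_def)
  have "path_sum z d (Suc m) j = A (Suc m) (z ^ j)"
    using Suc.prems(2)
  proof (induction "Suc d - j" arbitrary: j)
    case 0
    then have "j = Suc d" by simp
    moreover have "A (Suc m) (z ^ Suc d) = 0"
      unfolding A_def by (rule prod_zero) (auto simp: zd intro!: bexI[of _ 1])
    ultimately show ?case by simp
  next
    case (Suc e)
    then have j: "j \<le> d" "1 \<le> j" by auto
    have "path_sum z d (Suc m) j = z ^ j * path_sum z d m j + path_sum z d (Suc m) (Suc j)"
      using j by (simp add: sum.atLeast_Suc_atMost)
    also have "path_sum z d m j = A m (z ^ j)"
      unfolding A_def using j \<open>Suc m < d\<close> by (intro IH) auto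
    also have "path_sum z d (Suc m) (Suc j) = A (Suc m) (z ^ Suc j)"
      using Suc j by (intro Suc.hyps) auto
    finally show ?case using shift[of "z ^ j"] by simp
  qed
  then show ?case by (simp add: A_def)
qed simp

text \<open>The closed form ends at \<open>m = d - 1\<close>, as \<open>1 - z ^ d = 0\<close>, so
  the smallest label \<open>i\<close> is summed separately. For \<open>i < d\<close> the factor
  \<open>l = i\<close> of the product vanishes; for \<open>i = d\<close> the product is 1.\<close>

lemma path_sum_root_of_unity:
  fixes z :: "'b::field"
  assumes z: "primitive_root_of_unity d z" and j: "j \<in> {1..d}"
  shows "path_sum z d d j = 1"
proof -
  have d: "d > 0" and zd: "z ^ d = 1" using z by (auto simp: primitive_root_of_unity_def)
  then obtain m where m: "d = Suc m" by (cases d) auto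
  have closed: "path_sum z d m i = (\<Prod>l=1..m. (z ^ i - z ^ l) / (1 - z ^ l))" if "i \<in> {j..d}" for i
    using that j m by (intro path_sum_closed_form[OF z]) auto
  have "path_sum z d d j = (\<Sum>i=j..d. z ^ i * path_sum z d m i)"
    using m by simp
  also have "\<dots> = (\<Sum>i=j..d. if i = d then 1 else 0)"
  proof (rule sum.cong)
    fix i assume i: "i \<in> {j..d}"
    show "z ^ i * path_sum z d m i = (if i = d then 1 else 0)"
    proof (cases "i = d")
      case True
      have "(\<Prod>l=1..m. (z ^ d - z ^ l) / (1 - z ^ l)) = 1"
        using z m by (intro prod.neutral) (auto simp: primitive_root_of_unity_def)
      then show ?thesis using True zd closed[OF i] by simp
    next
      case False
      then have "path_sum z d m i = 0"
        unfolding closed[OF i] using i j m by (intro prod_zero) (auto intro!: bexI[of _ i])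
      then show ?thesis using False by simp
    qed
  qed simp
  also have "\<dots> = 1" using j by simp
  finally show ?thesis .
qed

section \<open>Removing a path from the label sum\<close>

text \<open>No edge from \<open>X\<close> enters \<open>v\<close>, so its label is bounded only from
  below: by the label of \<open>T v\<close>, or by 1 if \<open>v\<close> is a fixed point, such as
  the root under \<open>tree_endo\<close>.\<close>

lemma labelings_insert_leaf:
  assumes v: "v \<notin> X" "T v \<in> insert v X" and T: "T \<in> X \<rightarrow> X"
  shows "bij_betw (\<lambda>(f, i). f(v := i))
    (SIGMA f : labelings d X T. {(if T v = v then 1 else f (T v))..d}) (labelings d (insert v X) T)"
proof (rule bij_betw_byWitness[where f' = "\<lambda>g. (g(v := undefined), g v)"])
  let ?S = "SIGMA f : labelings d X T. {(if T v = v then 1 else f (T v))..d}"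
  show "\<forall>a\<in>?S. (\<lambda>g. (g(v := undefined), g v)) ((\<lambda>(f, i). f(v := i)) a) = a"
    using v by (auto simp: labelings_def PiE_iff extensional_def fun_eq_iff)
  show "\<forall>g\<in>labelings d (insert v X) T. (\<lambda>(f, i). f(v := i)) (g(v := undefined), g v) = g"
    by auto
  show "(\<lambda>(f, i). f(v := i)) ` ?S \<subseteq> labelings d (insert v X) T"
  proof clarify
    fix f i assume f: "f \<in> labelings d X T" and i: "i \<in> {(if T v = v then 1 else f (T v))..d}"
    have "1 \<le> (if T v = v then 1 else f (T v))"
      using v labelings_range[OF f, of "T v"] by auto
    then have "i \<in> {1..d}" using i by auto
    then show "f(v := i) \<in> labelings d (insert v X) T"
      using f i v T unfolding labelings_def by (auto simp: PiE_iff extensional_def split: if_splits)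
  qed
  show "(\<lambda>g. (g(v := undefined), g v)) ` labelings d (insert v X) T \<subseteq> ?S"
    using v T unfolding labelings_def by (auto simp: PiE_iff extensional_def Pi_iff)
qed

text \<open>One step of peeling a path off from its start. The factor
  \<open>path_sum z d m (f v)\<close> is the weight of \<open>m\<close> nodes already removed, with
  labels at least \<open>f v\<close>; summing over the label of \<open>v\<close> adds
  \<open>v\<close> to them and passes the bound on to \<open>T v\<close>.\<close>

lemma sum_labelings_insert_leaf:
  fixes z :: "'b::comm_semiring_1"
  assumes X: "finite X" and v: "v \<notin> X" "T v \<in> insert v X" and T: "T \<in> X \<rightarrow> X"
  shows "(\<Sum>f\<in>labelings d (insert v X) T. (\<Prod>x\<in>insert v X. z ^ f x) * path_sum z d m (f v)) =
    (\<Sum>f\<in>labelings d X T. (\<Prod>x\<in>X. z ^ f x) * path_sum z d (Suc m) (if T v = v then 1 else f (T v)))"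
proof -
  let ?lo = "\<lambda>f :: 'a \<Rightarrow> nat. if T v = v then 1 else f (T v)"
  have "(\<Sum>f\<in>labelings d (insert v X) T. (\<Prod>x\<in>insert v X. z ^ f x) * path_sum z d m (f v)) =
    (\<Sum>(f, i)\<in>(SIGMA f : labelings d X T. {?lo f..d}). (\<Prod>x\<in>X. z ^ f x) * (z ^ i * path_sum z d m i))"
  proof (subst sum.reindex_bij_betw[OF labelings_insert_leaf[OF v T], symmetric], rule sum.cong)
    fix a assume "a \<in> (SIGMA f : labelings d X T. {?lo f..d})"
    obtain f i where a: "a = (f, i)" by fastforce
    have "(\<Prod>x\<in>X. z ^ (f(v := i)) x) = (\<Prod>x\<in>X. z ^ f x)"
      using v by (intro prod.cong) auto
    then show "(\<Prod>x\<in>insert v X. z ^ (case a of (f, i) \<Rightarrow> f(v := i)) x) *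
        path_sum z d m ((case a of (f, i) \<Rightarrow> f(v := i)) v) =
        (case a of (f, i) \<Rightarrow> (\<Prod>x\<in>X. z ^ f x) * (z ^ i * path_sum z d m i))"
      using X v by (simp add: a algebra_simps)
  qed simp
  also have "\<dots> = (\<Sum>f\<in>labelings d X T. \<Sum>i=?lo f..d. (\<Prod>x\<in>X. z ^ f x) * (z ^ i * path_sum z d m i))"
    using X by (intro sum.Sigma[symmetric] finite_labelings) auto
  finally show ?thesis by (simp add: sum_distrib_left)
qed

definition label_sum :: "nat \<Rightarrow> 'b::comm_semiring_1 \<Rightarrow> 'a set \<Rightarrow> ('a \<Rightarrow> 'a) \<Rightarrow> 'b" where
  "label_sum d z X T = (\<Sum>f\<in>labelings d X T. \<Prod>x\<in>X. z ^ f x)"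

text \<open>By \<open>closed\<close> no other node enters the path, so it can be peeled off from
  \<open>w\<close> onwards. After all \<open>d\<close> nodes the accumulated factor is
  \<open>path_sum z d d j\<close> with \<open>j\<close> in \<open>{1..d}\<close>, which is 1. By
  \<open>final\<close>, the only edge from the end back into the path can be a loop at the
  end.\<close>

lemma label_sum_remove_path:
  fixes z :: "'b::field"
  assumes z: "primitive_root_of_unity d z" and X: "finite X" and T: "T \<in> X \<rightarrow> X"
    and inj: "inj_on (\<lambda>i. (T ^^ i) w) {..<d}" and P: "P = (\<lambda>i. (T ^^ i) w) ` {..<d}"
    and PX: "P \<subseteq> X" and closed: "\<And>x. x \<in> X - P \<Longrightarrow> T x \<notin> P"
    and final: "(T ^^ d) w \<in> P \<Longrightarrow> (T ^^ d) w = (T ^^ (d - 1)) w"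
  shows "label_sum d z X T = label_sum d z (X - P) T"
proof -
  have d: "d > 0" using z by (simp add: primitive_root_of_unity_def)
  define Y where "Y m = X - (\<lambda>i. (T ^^ i) w) ` {..<m}" for m
  have TY: "T \<in> Y m \<rightarrow> Y m" if m: "m \<le> d" for m
  proof
    fix x assume x: "x \<in> Y m"
    have "T x \<noteq> (T ^^ i) w" if i: "i < m" for i
    proof
      assume eq: "T x = (T ^^ i) w"
      \<comment> \<open>By \<open>closed\<close>, \<open>x\<close> lies on the path beyond the first
        \<open>m\<close> nodes; its image in the path is then the next node or, at the end,
        \<open>x\<close> itself, and neither is among the first \<open>m\<close>.\<close>
      then have "T x \<in> P" using i m P by auto
      then have "x \<in> P" using closed x by (auto simp: Y_def)
      then obtain l where l: "l < d" "x = (T ^^ l) w" using P by auto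
      then have lm: "m \<le> l" using x by (auto simp: Y_def not_le)
      show False
      proof (cases "Suc l < d")
        case True
        have "(T ^^ Suc l) w = (T ^^ i) w" using eq l by simp
        then have "Suc l = i" using inj_onD[OF inj, of "Suc l" i] True i m by simp
        then show False using lm i by simp
      next
        case False
        then have sl: "Suc l = d" using l by simp
        then have "(T ^^ d) w = (T ^^ i) w" using eq l by auto
        moreover from this have "(T ^^ d) w = (T ^^ l) w" using final sl i m P by auto
        ultimately have "l = i" using inj l i m by (auto dest: inj_onD)
        then show False using lm i by simp
      qed
    qed
    then show "T x \<in> Y m" using x T by (auto simp: Y_def)
  qed
  have YSuc: "Y m = insert ((T ^^ m) w) (Y (Suc m))" "(T ^^ m) w \<notin> Y (Suc m)" if m: "m < d" for m
  proof -
    have "(T ^^ m) w \<in> X" using PX P m by auto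
    moreover have "(T ^^ m) w \<noteq> (T ^^ i) w" if "i < m" for i
      using inj that m by (auto dest: inj_onD)
    ultimately show "Y m = insert ((T ^^ m) w) (Y (Suc m))" "(T ^^ m) w \<notin> Y (Suc m)"
      by (auto simp: Y_def lessThan_Suc)
  qed
  have finY: "finite (Y m)" for m using X by (simp add: Y_def)
  let ?F = "\<lambda>m n (f :: 'a \<Rightarrow> nat). (\<Prod>x\<in>Y m. z ^ f x) * path_sum z d m n"
  have TvY: "T ((T ^^ m) w) \<in> insert ((T ^^ m) w) (Y (Suc m))" if "m < d" for m
    using TY[of m] YSuc(1)[OF that] that by auto
  \<comment> \<open>The nodes before the last are no fixed points, being distinct from their
    successors; the last one may be, and is treated separately.\<close>
  have partial: "label_sum d z X T = (\<Sum>f\<in>labelings d (Y m) T. ?F m (f ((T ^^ m) w)) f)"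
    if "m < d" for m
    using that
  proof (induction m)
    case 0
    then show ?case by (simp add: label_sum_def Y_def)
  next
    case (Suc m)
    then have m: "m < d" by simp
    have "T ((T ^^ m) w) \<noteq> (T ^^ m) w"
      using inj_onD[OF inj, of "Suc m" m] Suc.prems by auto
    then show ?case
      using sum_labelings_insert_leaf[OF finY YSuc(2)[OF m] TvY[OF m] TY[of "Suc m"], where d = d and z = z and m = m]
        Suc m by (simp add: YSuc(1)[OF m, symmetric])
  qed
  obtain m where m: "d = Suc m" using d by (cases d) auto
  then have md: "m < d" by simp
  let ?v = "(T ^^ m) w"
  have "label_sum d z X T = (\<Sum>f\<in>labelings d (Y d) T. ?F d (if T ?v = ?v then 1 else f (T ?v)) f)"
    using sum_labelings_insert_leaf[OF finY YSuc(2)[OF md] TvY[OF md] TY[of "Suc m"], where d = d and z = z and m = m]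
      partial[OF md] unfolding YSuc(1)[OF md, symmetric] m by simp
  also have "\<dots> = label_sum d z (Y d) T"
    unfolding label_sum_def
  proof (rule sum.cong)
    fix f assume f: "f \<in> labelings d (Y d) T"
    have "(if T ?v = ?v then 1 else f (T ?v)) \<in> {1..d}"
      using TvY[OF md] d labelings_range[OF f, of "T ?v"] m by auto
    then show "?F d (if T ?v = ?v then 1 else f (T ?v)) f = (\<Prod>x\<in>Y d. z ^ f x)"
      using path_sum_root_of_unity[OF z] by simp
  qed simp
  finally show ?thesis by (simp add: Y_def P)
qed

section \<open>Tilings by directed paths\<close>

text \<open>\<open>W\<close> holds the starting points. The bijection says at once that the tiles
  cover \<open>Z\<close>, are disjoint and have \<open>d\<close> distinct nodes each.\<close>

definition tiling :: "nat \<Rightarrow> ('a \<Rightarrow> 'a) \<Rightarrow> 'a set \<Rightarrow> 'a set \<Rightarrow> bool" where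
  "tiling d T W Z \<longleftrightarrow> bij_betw (\<lambda>(w, i). (T ^^ i) w) (W \<times> {..<d}) Z"

abbreviation tile :: "nat \<Rightarrow> ('a \<Rightarrow> 'a) \<Rightarrow> 'a \<Rightarrow> 'a set" where
  "tile d T w \<equiv> (\<lambda>i. (T ^^ i) w) ` {..<d}"

lemma tiling_eqD:
  assumes "tiling d T W Z" "w \<in> W" "w' \<in> W" "i < d" "j < d" "(T ^^ i) w = (T ^^ j) w'"
  shows "w = w'" "i = j"
  using assms inj_onD[of "\<lambda>(w, i). (T ^^ i) w" "W \<times> {..<d}" "(w, i)" "(w', j)"]
  by (auto simp: tiling_def bij_betw_def)

lemma tiling_eq: "tiling d T W Z \<Longrightarrow> Z = (\<Union>w\<in>W. tile d T w)"
  by (auto simp: tiling_def bij_betw_def)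

lemma tiling_mem: "tiling d T W Z \<Longrightarrow> w \<in> W \<Longrightarrow> i < d \<Longrightarrow> (T ^^ i) w \<in> Z"
  unfolding tiling_def using bij_betwE by fastforce

lemma tiling_subset: "tiling d T W Z \<Longrightarrow> d > 0 \<Longrightarrow> W \<subseteq> Z"
  by (metis funpow_0 subsetI tiling_mem)

lemma tiling_remove:
  assumes W: "tiling d T W Z" and w: "w \<in> W"
  shows "tiling d T (W - {w}) (Z - tile d T w)"
proof -
  have "inj_on (\<lambda>(w, i). (T ^^ i) w) ((W - {w}) \<times> {..<d})"
    using W by (auto simp: tiling_def bij_betw_def intro: inj_on_subset)
  moreover have "(\<lambda>(w, i). (T ^^ i) w) ` ((W - {w}) \<times> {..<d}) = Z - tile d T w"
    using tiling_eq[OF W] tiling_eqD(1)[OF W _ w] by fastforce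
  ultimately show ?thesis by (simp add: tiling_def bij_betw_def)
qed

text \<open>Take the tile whose end is highest under \<open>h\<close>. Another tile could enter it
  only from its own end, along an edge that lowers \<open>h\<close>; but the chosen end is the
  lowest node of its tile and no other end is higher. So the tile can be removed as a path.\<close>

lemma label_sum_remove_tiling:
  fixes z :: "'b::field" and h :: "'a \<Rightarrow> nat"
  assumes z: "primitive_root_of_unity d z" and "finite X" "T \<in> X \<rightarrow> X"
    and Y: "Y \<subseteq> X" "T \<in> Y \<rightarrow> Y" and "tiling d T W (X - Y)"
    and "\<And>x. x \<in> X - Y \<Longrightarrow> T x \<noteq> x \<Longrightarrow> h (T x) < h x"
  shows "label_sum d z X T = label_sum d z Y T"
  using assms(2-)
proof (induction "card (X - Y)" arbitrary: X W rule: less_induct)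
  case less
  note X = less.prems(1) and T = less.prems(2) and YX = less.prems(3) and W = less.prems(5)
    and h = less.prems(6)
  have d: "d > 0" using z by (simp add: primitive_root_of_unity_def)
  have WX: "W \<subseteq> X - Y" using tiling_subset[OF W d] .
  then have finW: "finite W" using X finite_subset by blast
  show ?case
  proof (cases "W = {}")
    case True
    then have "X - Y = {}" using tiling_eq[OF W] by simp
    then have "X = Y" using YX by blast
    then show ?thesis by simp
  next
    case False
    define path_end where "path_end = (T ^^ (d - 1))"
    obtain w where w: "w \<in> W" and max: "\<And>w'. w' \<in> W \<Longrightarrow> h (path_end w') \<le> h (path_end w)"
      using obtains_MAX[OF finW False, of "\<lambda>w. h (path_end w)"] finW by (metis Max_ge finite_imageI imageI)
    let ?P = "tile d T w"
    have PX: "?P \<subseteq> X - Y" using tiling_eq[OF W] w by blast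
    have wP: "w \<in> ?P" using d by force
    have h': "h (T x) \<le> h x" if "x \<in> X - Y" for x
      using h[OF that] by (cases "T x = x") auto
    have end_le: "h (path_end w) \<le> h x" if x: "x \<in> ?P" for x
    proof -
      obtain i where i: "i < d" "x = (T ^^ i) w" using x by auto
      have "h ((T ^^ j) w) \<le> h x" if "i \<le> j" "j < d" for j
        using that
      proof (induction rule: dec_induct)
        case (step n)
        then have "(T ^^ n) w \<in> X - Y" using tiling_mem[OF W w] by auto
        from h'[OF this] step show ?case by auto
      qed (simp add: i)
      then show ?thesis using i unfolding path_end_def by simp
    qed
    have end_in: "path_end w' \<in> X - Y" if "w' \<in> W" for w'
      using that d tiling_mem[OF W, of w' "d - 1"] by (simp add: path_end_def)
    \<comment> \<open>The end is lowest in its tile, so an edge from it back into the tile cannot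
      descend and must be a loop.\<close>
    have final: "(T ^^ d) w = (T ^^ (d - 1)) w" if "(T ^^ d) w \<in> ?P"
    proof -
      have Td: "(T ^^ d) w = T (path_end w)"
        using d by (cases d) (auto simp: path_end_def)
      then show ?thesis using end_le[OF that] h[OF end_in[OF w]] by (fastforce simp: path_end_def)
    qed
    have closed: "T x \<notin> ?P" if x: "x \<in> X - ?P" for x
    proof
      assume Tx: "T x \<in> ?P"
      then have xY: "x \<in> X - Y" using x PX Y by auto
      then obtain w' j where w': "w' \<in> W" "j < d" "x = (T ^^ j) w'"
        using tiling_eq[OF W] by auto
      \<comment> \<open>Only the end of a tile can be mapped into another tile.\<close>
      have "Suc j = d"
      proof (rule ccontr)
        assume "Suc j \<noteq> d"
        then have "Suc j < d" using w' by simp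
        moreover obtain i where "i < d" "T x = (T ^^ i) w" using Tx by auto
        ultimately have "w' = w"
          using tiling_eqD(1)[OF W \<open>w' \<in> W\<close> w, of "Suc j" i] w' by simp
        then show False using x w' by auto
      qed
      then have "x = path_end w'" using w' by (auto simp: path_end_def)
      moreover have "T x \<noteq> x" using x Tx by auto
      ultimately show False using h[OF xY] end_le[OF Tx] max[OF w'(1)] by auto
    qed
    have inj: "inj_on (\<lambda>i. (T ^^ i) w) {..<d}"
      using tiling_eqD(2)[OF W w w] by (auto intro: inj_onI)
    have "label_sum d z X T = label_sum d z (X - ?P) T"
      using PX by (intro label_sum_remove_path[OF z X T inj refl _ closed final]) auto
    also have "\<dots> = label_sum d z Y T"
    proof (rule less.hyps)
      show "card (X - ?P - Y) < card (X - Y)"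
        using PX wP X by (intro psubset_card_mono) auto
      show "T \<in> X - ?P \<rightarrow> X - ?P" using T closed by auto
      have "X - ?P - Y = X - Y - ?P" by blast
      then show "tiling d T (W - {w}) (X - ?P - Y)"
        using tiling_remove[OF W w] by simp
    qed (use X YX PX Y h in auto)
    finally show ?thesis .
  qed
qed

lemma label_sum_empty [simp]: "label_sum d z {} T = 1"
  by (simp add: label_sum_def labelings_def)

text \<open>Since \<open>W \<times> {..<d}\<close> has as many elements as \<open>X\<close>,
  covering \<open>X\<close> already forces injectivity.\<close>

lemma splitting_iff_tiling:
  assumes "finite X" "d > 0"
  shows "splitting d X S W \<longleftrightarrow> tiling d S W X"
proof
  assume L: "splitting d X S W"
  then have "card (W \<times> {..<d}) = card X" by (simp add: splitting_def card_cartesian_product)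
  moreover have img: "(\<lambda>(w, i). (S ^^ i) w) ` (W \<times> {..<d}) = X"
    using L by (auto simp: splitting_def)
  moreover have "finite W" using L assms finite_subset by (auto simp: splitting_def)
  ultimately have "inj_on (\<lambda>(w, i). (S ^^ i) w) (W \<times> {..<d})"
    by (intro eq_card_imp_inj_on) auto
  with img show "tiling d S W X" by (simp add: tiling_def bij_betw_def)
next
  assume R: "tiling d S W X"
  have "card X = card W * d"
    using bij_betw_same_card[OF R[unfolded tiling_def]] by (simp add: card_cartesian_product)
  moreover have "(\<Union>i<d. (S ^^ i) ` W) = X" using tiling_eq[OF R] by auto
  ultimately show "splitting d X S W"
    using tiling_subset[OF R] assms by (simp add: splitting_def)
qed

text \<open>A start \<open>w\<close> of greatest height in \<open>W\<close> has no preimage in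
  \<open>Z\<close>, which would be the end of a tile with a higher start. Hence \<open>w\<close> is
  a start in every tiling, and its tile can be removed. Heights are compared only along jumps from
  start to start, so \<open>T\<close> may have cycles.\<close>

lemma tiling_unique:
  fixes h :: "'a \<Rightarrow> nat"
  assumes d: "d > 0" and "finite Z" and "tiling d T W Z" "tiling d T W' Z"
    and "\<And>w. w \<in> W \<Longrightarrow> (T ^^ d) w \<in> W \<Longrightarrow> h ((T ^^ d) w) < h w"
  shows "W = W'"
  using assms(2-)
proof (induction "card Z" arbitrary: Z W W' rule: less_induct)
  case less
  note Z = less.prems(1) and W = less.prems(2) and W' = less.prems(3) and h = less.prems(4)
  have WZ: "W \<subseteq> Z" using tiling_subset[OF W d] .
  then have finW: "finite W" using Z finite_subset by blast
  show ?case
  proof (cases "W = {}")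
    case True
    then show ?thesis using tiling_eq[OF W] tiling_subset[OF W' d] by auto
  next
    case False
    obtain w where w: "w \<in> W" and max: "\<And>w'. w' \<in> W \<Longrightarrow> h w' \<le> h w"
      using obtains_MAX[OF finW False, of h] finW by (metis Max_ge finite_imageI imageI)
    have notin: "w \<notin> T ` Z"
    proof
      assume "w \<in> T ` Z"
      then obtain w' j where w': "w' \<in> W" "j < d" "w = T ((T ^^ j) w')"
        using tiling_eq[OF W] by auto
      have "Suc j = d"
        using tiling_eqD(2)[OF W w'(1) w, of "Suc j" 0] w' d by (cases "Suc j < d") auto
      then have "(T ^^ d) w' = w" using w' by auto
      then show False using h[OF w'(1)] max[OF w'(1)] w by auto
    qed
    have "w \<in> Z" using w WZ by auto
    then obtain w' j where w': "w' \<in> W'" "j < d" "w = (T ^^ j) w'"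
      using tiling_eq[OF W'] by auto
    have "j = 0"
    proof (cases j)
      case (Suc i)
      then have "(T ^^ i) w' \<in> Z" using w' tiling_mem[OF W'] by auto
      then show ?thesis using notin w' Suc by auto
    qed
    then have wW': "w \<in> W'" using w' by simp
    have "w \<in> tile d T w" using d by force
    then have "card (Z - tile d T w) < card Z"
      using w WZ Z by (intro psubset_card_mono) auto
    then have "W - {w} = W' - {w}"
      using tiling_remove[OF W w] tiling_remove[OF W' wW'] Z h by (intro less.hyps) auto
    then show ?thesis using w wW' by blast
  qed
qed

lemma tiling_Un:
  assumes "tiling d T W Z" "tiling d T W' Z'" "Z \<inter> Z' = {}"
  shows "tiling d T (W \<union> W') (Z \<union> Z')"
  using bij_betw_combine[OF assms[unfolded tiling_def]] by (simp add: tiling_def Sigma_Un_distrib1)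

lemma tiling_UN:
  assumes "\<And>i. i \<in> I \<Longrightarrow> tiling d T (W i) (Z i)" "disjoint_family_on Z I"
  shows "tiling d T (\<Union>i\<in>I. W i) (\<Union>i\<in>I. Z i)"
proof -
  have "bij_betw (\<lambda>(w, i). (T ^^ i) w) (\<Union>i\<in>I. W i \<times> {..<d}) (\<Union>i\<in>I. Z i)"
    using assms by (intro bij_betw_UNION_disjoint) (auto simp: tiling_def)
  moreover have "(\<Union>i\<in>I. W i \<times> {..<d}) = (\<Union>i\<in>I. W i) \<times> {..<d}" by blast
  ultimately show ?thesis by (simp add: tiling_def)
qed

text \<open>\<open>tree_endo T r\<close> differs from \<open>T\<close> only at \<open>r\<close>,
  which it fixes. The nodes of a tile are distinct, so \<open>r\<close> can only be the end of a
  tile, and the iterates below \<open>d\<close> agree.\<close>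

lemma tiling_tree_endo:
  assumes W: "tiling d (tree_endo T r) W Z"
  shows "tiling d T W Z"
proof -
  have "(tree_endo T r ^^ i) w = (T ^^ i) w" if "w \<in> W" "i < d" for w i
    using that(2)
  proof (induction i)
    case (Suc i)
    have "(tree_endo T r ^^ i) w \<noteq> r"
      using tiling_eqD(2)[OF W that(1) that(1), of "Suc i" i] Suc.prems
      by (auto simp: tree_endo_def)
    then show ?case using Suc by (auto simp: tree_endo_def)
  qed simp
  then show ?thesis
    using W unfolding tiling_def by (subst bij_betw_cong[symmetric]) auto
qed

text \<open>Cuts the \<open>d * s\<close> nodes after \<open>c\<close> into \<open>s\<close>
  consecutive blocks; quotient and remainder give block and position. This tiles the cycle without
  \<open>c\<close>.\<close>

lemma tiling_path:
  assumes inj: "inj_on (\<lambda>i. (T ^^ i) c) {1..d * s}"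
  shows "tiling d T ((\<lambda>j. (T ^^ (d * j + 1)) c) ` {..<s}) ((\<lambda>i. (T ^^ i) c) ` {1..d * s})"
  unfolding tiling_def
proof (rule bij_betw_imageI)
  let ?W = "(\<lambda>j. (T ^^ (d * j + 1)) c) ` {..<s}"
  have shift: "(T ^^ i) ((T ^^ (d * j + 1)) c) = (T ^^ (d * j + i + 1)) c" for i j
    using funpow_add[of i "d * j + 1" T] by (simp add: ac_simps)
  have range: "d * j + i + 1 \<in> {1..d * s}" if "i < d" "j < s" for i j
  proof -
    have "d * j + i + 1 \<le> d * Suc j" using that by simp
    also have "\<dots> \<le> d * s" using that by (intro mult_le_mono) auto
    finally show ?thesis by simp
  qed
  show "inj_on (\<lambda>(w, i). (T ^^ i) w) (?W \<times> {..<d})"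
  proof (rule inj_onI, clarify)
    fix j j' i i' assume b: "j < s" "j' < s" "i < d" "i' < d"
      and eq: "(T ^^ i) ((T ^^ (d * j + 1)) c) = (T ^^ i') ((T ^^ (d * j' + 1)) c)"
    have "d * j + i + 1 = d * j' + i' + 1"
      using inj_onD[OF inj eq[unfolded shift] range range] b by simp
    then have e: "d * j + i = d * j' + i'" by simp
    have "i = i'" using arg_cong[OF e, of "\<lambda>m. m mod d"] b by simp
    moreover have "j = j'" using e calculation b by simp
    ultimately show "(T ^^ (d * j + 1)) c = (T ^^ (d * j' + 1)) c \<and> i = i'" by simp
  qed
  show "(\<lambda>(w, i). (T ^^ i) w) ` (?W \<times> {..<d}) = (\<lambda>i. (T ^^ i) c) ` {1..d * s}" (is "?L = ?R")
  proof
    show "?L \<subseteq> ?R" using range by (auto simp only: shift intro!: image_eqI)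
    show "?R \<subseteq> ?L"
    proof (rule image_subsetI)
      fix m assume m: "m \<in> {1..d * s}"
      then have d: "d > 0" by (cases d) auto
      \<comment> \<open>Positions in the segment start at 1, so \<open>m - 1\<close> is the number
        to divide by \<open>d\<close>.\<close>
      have "m - 1 < s * d" using m by (auto simp: mult.commute)
      then have "(m - 1) div d < s" using d by (simp add: div_less_iff_less_mult)
      moreover have "(m - 1) mod d < d" using d by simp
      moreover have "(T ^^ m) c = (T ^^ ((m - 1) mod d)) ((T ^^ (d * ((m - 1) div d) + 1)) c)"
        unfolding shift using m by simp
      ultimately show "(T ^^ m) c \<in> ?L"
        by (intro image_eqI[where x = "((T ^^ (d * ((m - 1) div d) + 1)) c, (m - 1) mod d)"]) auto
    qed
  qed
qed

section \<open>Contracting the cycle\<close>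

text \<open>Labels never increase along edges, so they are constant on the cycle. It contributes
  \<open>(z ^ card C) ^ f c = z ^ f c\<close>, the weight of the single node \<open>c\<close>, where
  all edges from \<open>B\<close> into \<open>C\<close> end.\<close>

lemma label_sum_collapse_cycle:
  fixes z :: "'b::comm_semiring_1"
  assumes fin: "finite C" "finite B" and CB: "C \<inter> B = {}" and c: "c \<in> C"
    and TC: "T \<in> C \<rightarrow> C" and to: "\<And>x. x \<in> C \<Longrightarrow> \<exists>i. (T ^^ i) x = c"
    and from': "\<And>x. x \<in> C \<Longrightarrow> \<exists>i. (T ^^ i) c = x"
    and TB: "T \<in> B \<rightarrow> insert c B" and z: "z ^ card C = z"
  shows "label_sum d z (C \<union> B) T = label_sum d z (insert c B) (tree_endo T c)"
  unfolding label_sum_def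
proof (rule sum.reindex_bij_witness[where j = "\<lambda>f. restrict f (insert c B)"
      and i = "\<lambda>g. \<lambda>x\<in>C \<union> B. if x \<in> C then g c else g x"])
  have const: "f c = f x" if f: "f \<in> labelings d (C \<union> B) T" and x: "x \<in> C" for f x
  proof -
    have iter: "f ((T ^^ i) y) \<le> f y \<and> (T ^^ i) y \<in> C" if y: "y \<in> C" for y i
    proof (induction i)
      case (Suc i)
      then have "f (T ((T ^^ i) y)) \<le> f ((T ^^ i) y)"
        using labelings_le[OF f] by blast
      then show ?case using Suc TC by auto
    qed (use y in simp)
    obtain i where "(T ^^ i) x = c" using to[OF x] by blast
    moreover obtain j where "(T ^^ j) c = x" using from'[OF x] by blast
    ultimately show ?thesis using iter[OF x, of i] iter[OF c, of j] by simp
  qed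
  fix f assume f: "f \<in> labelings d (C \<union> B) T"
  show "(\<lambda>x\<in>C \<union> B. if x \<in> C then restrict f (insert c B) c else restrict f (insert c B) x) = f"
  proof
    fix x
    have "f x = undefined" if "x \<notin> C \<union> B" using f that by (auto simp: labelings_def)
    then show "(\<lambda>x\<in>C \<union> B. if x \<in> C then restrict f (insert c B) c else restrict f (insert c B) x) x = f x"
      using const[OF f, of x] by auto
  qed
  show "restrict f (insert c B) \<in> labelings d (insert c B) (tree_endo T c)"
    unfolding labelings_def
  proof (intro CollectI conjI ballI)
    show "restrict f (insert c B) \<in> insert c B \<rightarrow>\<^sub>E {1..d}"
      using labelings_range[OF f] c by auto
    fix x assume x: "x \<in> insert c B"
    show "restrict f (insert c B) (tree_endo T c x) \<le> restrict f (insert c B) x"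
    proof (cases "x = c")
      case False
      then have "T x \<in> insert c B" "f (T x) \<le> f x" using x TB labelings_le[OF f, of x] by auto
      then show ?thesis using x False by (simp add: tree_endo_def)
    qed (simp add: tree_endo_def)
  qed
  have "(\<Prod>x\<in>C. z ^ f x) = (\<Prod>x\<in>C. z ^ f c)"
    by (rule prod.cong[OF refl], simp add: const[OF f])
  also have "\<dots> = (z ^ card C) ^ f c"
    by (simp add: power_mult[symmetric] mult.commute)
  also have "\<dots> = z ^ f c" by (simp only: z)
  finally show "(\<Prod>x\<in>insert c B. z ^ restrict f (insert c B) x) = (\<Prod>x\<in>C \<union> B. z ^ f x)"
    using fin CB c by (subst prod.union_disjoint) (auto simp: disjoint_iff)
next
  fix g assume g: "g \<in> labelings d (insert c B) (tree_endo T c)"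
  show "restrict (\<lambda>x\<in>C \<union> B. if x \<in> C then g c else g x) (insert c B) = g"
  proof
    fix x
    have "g x = undefined" if "x \<notin> insert c B" using g that by (auto simp: labelings_def)
    then show "restrict (\<lambda>x\<in>C \<union> B. if x \<in> C then g c else g x) (insert c B) x = g x"
      using c CB by auto
  qed
  have le: "g (T x) \<le> g x" if "x \<in> B" for x
    using labelings_le[OF g, of x] that CB c by (auto simp: tree_endo_def split: if_splits)
  show "(\<lambda>x\<in>C \<union> B. if x \<in> C then g c else g x) \<in> labelings d (C \<union> B) T"
    unfolding labelings_def
  proof (intro CollectI conjI ballI)
    show "(\<lambda>x\<in>C \<union> B. if x \<in> C then g c else g x) \<in> C \<union> B \<rightarrow>\<^sub>E {1..d}"
      using labelings_range[OF g] by auto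
    fix x assume x: "x \<in> C \<union> B"
    show "(\<lambda>x\<in>C \<union> B. if x \<in> C then g c else g x) (T x)
        \<le> (\<lambda>x\<in>C \<union> B. if x \<in> C then g c else g x) x"
    proof (cases "x \<in> C")
      case True
      then have "T x \<in> C" using TC by auto
      then show ?thesis using True by simp
    next
      case False
      then have xB: "x \<in> B" using x by simp
      then have "T x = c \<or> T x \<in> B" using TB by auto
      then show ?thesis using False xB c CB le[OF xB] by auto
    qed
  qed
qed

section \<open>Cycle and attached trees of a connected endofunction\<close>

lemma funpow_mult_fixed: "(f ^^ p) x = x \<Longrightarrow> (f ^^ (p * m)) x = x"
  by (induction m) (auto simp: funpow_add)

locale connected_endofunction =
  fixes X :: "'a set" and T :: "'a \<Rightarrow> 'a"
  assumes finite_X: "finite X" and T_closed: "T \<in> X \<rightarrow> X" and connected: "connected_endo X T"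
begin

abbreviation "C \<equiv> cycle_nodes X T"

lemma funpow_closed: "x \<in> X \<Longrightarrow> (T ^^ i) x \<in> X"
  using T_closed by (induction i) auto

text \<open>Induction along an undirected path: an edge crossed forwards adds a step from
  \<open>x\<close>, one crossed backwards adds a step from the other end.\<close>

lemma orbits_meet:
  assumes "x \<in> X" "y \<in> X"
  shows "\<exists>i j. (T ^^ i) x = (T ^^ j) y"
proof -
  have "(x, y) \<in> (functional_graph X T \<union> (functional_graph X T)\<inverse>)\<^sup>*"
    using connected assms by (simp add: connected_endo_def)
  then show ?thesis
  proof (induction rule: rtrancl_induct)
    case (step y z)
    then obtain i j where ij: "(T ^^ i) x = (T ^^ j) y" by blast
    from step(2) have "z = T y \<or> y = T z" by (auto simp: functional_graph_def)
    then show ?case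
    proof
      assume "z = T y"
      then have "(T ^^ Suc i) x = (T ^^ j) z" using ij by (simp add: funpow_swap1)
      then show ?thesis by blast
    next
      assume "y = T z"
      then have "(T ^^ i) x = (T ^^ Suc j) z" using ij by (simp add: funpow_swap1)
      then show ?thesis by blast
    qed
  qed blast
qed

text \<open>From a point common to both orbits, walk on until the number of steps from
  \<open>c\<close> is a multiple of its period. In particular there is only one cycle.\<close>

lemma reach_cycle_node:
  assumes x: "x \<in> X" and c: "c \<in> C"
  shows "\<exists>i. (T ^^ i) x = c"
proof -
  obtain p where p: "p > 0" "(T ^^ p) c = c" and cX: "c \<in> X" using c by (auto simp: cycle_nodes_def)
  obtain i j where ij: "(T ^^ i) x = (T ^^ j) c" using orbits_meet[OF x cX] by blast
  have "j \<le> p * j" using p by simp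
  then have "(T ^^ (p * j - j + i)) x = (T ^^ (p * j)) c"
    using ij by (metis funpow_add le_add_diff_inverse2 o_apply)
  then show ?thesis using funpow_mult_fixed[OF p(2)] by metis
qed

lemma T_cycle: "T \<in> C \<rightarrow> C"
proof
  fix x assume "x \<in> C"
  then obtain i where "x \<in> X" "i > 0" "(T ^^ i) x = x" by (auto simp: cycle_nodes_def)
  moreover from this have "(T ^^ i) (T x) = T x" by (metis funpow_swap1)
  ultimately show "T x \<in> C" using T_closed by (auto simp: cycle_nodes_def)
qed

lemma funpow_cycle: "x \<in> C \<Longrightarrow> (T ^^ i) x \<in> C"
  using T_cycle by (induction i) auto

lemma cycle_param:
  assumes c: "c \<in> C"
  shows "bij_betw (\<lambda>i. (T ^^ i) c) {..<card C} C" "(T ^^ card C) c = c"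
proof -
  define p where "p = (LEAST p. p > 0 \<and> (T ^^ p) c = c)"
  have "\<exists>p. p > 0 \<and> (T ^^ p) c = c" and cX: "c \<in> X" using c by (auto simp: cycle_nodes_def)
  then have p: "p > 0" "(T ^^ p) c = c" unfolding p_def by (metis (mono_tags, lifting) LeastI)+
  have least: "\<not> (0 < i \<and> (T ^^ i) c = c)" if "i < p" for i
    using that not_less_Least unfolding p_def by blast
  have "(T ^^ i) c \<noteq> (T ^^ j) c" if "i < j" "j < p" for i j
  proof
    assume "(T ^^ i) c = (T ^^ j) c"
    \<comment> \<open>Another \<open>p - j\<close> steps lead back to \<open>c\<close> after
      \<open>p - j + i < p\<close> steps in all, against the minimality of \<open>p\<close>.\<close>
    then have "(T ^^ (p - j + i)) c = (T ^^ (p - j + j)) c" by (simp add: funpow_add)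
    moreover have "p - j + j = p" "p - j + i < p" "0 < p - j + i" using that by linarith+
    ultimately show False using least[of "p - j + i"] p by simp
  qed
  then have inj: "inj_on (\<lambda>i. (T ^^ i) c) {..<p}"
    by (intro inj_onI) (metis lessThan_iff linorder_neqE_nat)
  have "C \<subseteq> (\<lambda>i. (T ^^ i) c) ` {..<p}"
  proof
    fix x assume "x \<in> C"
    then obtain i where "(T ^^ i) c = x" using reach_cycle_node[OF cX] by blast
    then have "(T ^^ (i mod p)) c = x" using funpow_mod_eq[OF p(2)] by metis
    then show "x \<in> (\<lambda>i. (T ^^ i) c) ` {..<p}" using p by auto
  qed
  then have bij: "bij_betw (\<lambda>i. (T ^^ i) c) {..<p} C"
    using inj funpow_cycle[OF c] by (auto simp: bij_betw_def)
  then have "card C = p" using bij_betw_same_card by fastforce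
  then show "bij_betw (\<lambda>i. (T ^^ i) c) {..<card C} C" "(T ^^ card C) c = c" using bij p by auto
qed

text \<open>Serves as the height \<open>h\<close> for removing tiles and for uniqueness. For
  \<open>e\<close> on the cycle it descends along every edge except the one that leaves
  \<open>e\<close>.\<close>

definition dist_to :: "'a \<Rightarrow> 'a \<Rightarrow> nat" where
  "dist_to e x = (LEAST i. (T ^^ i) x = e)"

lemma dist_to_less:
  assumes x: "x \<in> X" "x \<noteq> e" and e: "e \<in> C"
  shows "dist_to e (T x) < dist_to e x"
proof -
  have eq: "(T ^^ dist_to e x) x = e"
    using reach_cycle_node[OF x(1) e] unfolding dist_to_def by (rule LeastI_ex)
  then obtain i where i: "dist_to e x = Suc i" using x by (cases "dist_to e x") auto
  then have "(T ^^ i) (T x) = e" using eq by (simp add: funpow_swap1)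
  then have "dist_to e (T x) \<le> i" unfolding dist_to_def by (rule Least_le)
  then show ?thesis using i by simp
qed

lemma dist_to_funpow_less:
  assumes w: "w \<in> X" and e: "e \<in> C" and "0 < m" and "\<And>i. i < m \<Longrightarrow> (T ^^ i) w \<noteq> e"
  shows "dist_to e ((T ^^ m) w) < dist_to e w"
  using assms(3,4)
proof (induction m)
  case (Suc m)
  have "dist_to e ((T ^^ Suc m) w) < dist_to e ((T ^^ m) w)"
    using dist_to_less[OF funpow_closed[OF w] _ e] Suc.prems by simp
  also have "dist_to e ((T ^^ m) w) \<le> dist_to e w"
    using Suc by (cases m) (auto intro: less_imp_le)
  finally show ?case .
qed simp

abbreviation "tree \<equiv> attached_tree X T"

lemma tree_cycle_disjoint: "v \<in> attached_roots X T \<Longrightarrow> tree v \<inter> C = {}"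
  using funpow_cycle by (auto simp: attached_roots_def attached_tree_def)

lemma T_tree:
  assumes "x \<in> tree v" "x \<noteq> v"
  shows "T x \<in> tree v"
proof -
  obtain i where i: "x \<in> X" "(T ^^ i) x = v" using assms by (auto simp: attached_tree_def)
  then obtain j where "i = Suc j" using assms by (cases i) auto
  then have "(T ^^ j) (T x) = v" using i by (simp add: funpow_swap1)
  then show ?thesis using i T_closed by (auto simp: attached_tree_def)
qed

text \<open>If the orbit of \<open>x\<close> met \<open>v\<close> strictly before \<open>v'\<close>,
  then \<open>v'\<close> would be on the orbit of \<open>T v\<close>, hence on the cycle. So both
  are met after the same number of steps.\<close>

lemma trees_disjoint:
  assumes "v \<in> attached_roots X T" "v' \<in> attached_roots X T" "x \<in> tree v" "x \<in> tree v'"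
  shows "v = v'"
proof -
  have aux: "i \<ge> j"
    if "v \<in> attached_roots X T" "v' \<in> attached_roots X T" "(T ^^ i) x = v" "(T ^^ j) x = v'"
    for v v' i j
  proof (rule ccontr)
    assume "\<not> i \<ge> j"
    then obtain m where "j = m + Suc i" using less_iff_Suc_add[of i j] by auto
    then have "v' = (T ^^ m) (T v)" using that(3,4) by (auto simp: funpow_add funpow_swap1)
    then have "v' \<in> C" using that(1) funpow_cycle by (auto simp: attached_roots_def)
    then show False using that(2) by (simp add: attached_roots_def)
  qed
  obtain i j where ij: "(T ^^ i) x = v" "(T ^^ j) x = v'" using assms by (auto simp: attached_tree_def)
  have "i = j"
    using aux[OF assms(1,2) ij] aux[OF assms(2,1) ij(2,1)] by (rule le_antisym[rotated])
  then show ?thesis using ij by simp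
qed

text \<open>The last node before the orbit of \<open>x\<close> enters the cycle is the root of the
  tree that contains \<open>x\<close>.\<close>

lemma union_trees:
  assumes "C \<noteq> {}"
  shows "(\<Union>v\<in>attached_roots X T. tree v) = X - C"
proof
  show "(\<Union>v\<in>attached_roots X T. tree v) \<subseteq> X - C"
    using tree_cycle_disjoint by (auto simp: attached_tree_def)
  show "X - C \<subseteq> (\<Union>v\<in>attached_roots X T. tree v)"
  proof
    fix x assume x: "x \<in> X - C"
    obtain c where "c \<in> C" using assms by blast
    moreover from this obtain i where "(T ^^ i) x = c" using reach_cycle_node[of x c] x by blast
    ultimately have ex: "\<exists>i. (T ^^ i) x \<in> C" by blast
    define i where "i = (LEAST i. (T ^^ i) x \<in> C)"
    have i: "(T ^^ i) x \<in> C" unfolding i_def using ex by (rule LeastI_ex)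
    then obtain j where j: "i = Suc j" using x by (cases i) auto
    then have "(T ^^ j) x \<notin> C" using not_less_Least[of j "\<lambda>i. (T ^^ i) x \<in> C"] by (simp add: i_def)
    then have "(T ^^ j) x \<in> attached_roots X T"
      using i j x funpow_closed by (auto simp: attached_roots_def)
    moreover have "x \<in> tree ((T ^^ j) x)" using x by (auto simp: attached_tree_def)
    ultimately show "x \<in> (\<Union>v\<in>attached_roots X T. tree v)" by blast
  qed
qed

end

section \<open>Label sum and splitting subsets of the whole graph\<close>

text \<open>Settles \<open>d = 1\<close>, where every node is a start and no height can descend from
  start to start around the cycle, as \<open>tiling_unique\<close> demands.\<close>

lemma splitting_1_iff:
  assumes "finite X"
  shows "splitting 1 X T W \<longleftrightarrow> W = X"
  using card_subset_eq[OF assms, of W] by (auto simp: splitting_def)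

text \<open>The situation of the theorem with splitting subsets chosen and expressed as tilings:
  \<open>v\<close> is the root of the last tree, \<open>V u\<close> belongs to the tree with root
  \<open>u\<close>, and \<open>W\<^sub>0\<close> to the last tree with its cycle node.\<close>

locale unicyclic_tiled = connected_endofunction +
  fixes d s :: nat and v :: 'a and V :: "'a \<Rightarrow> 'a set" and W\<^sub>0 :: "'a set"
  assumes d: "d > 0" and card_cycle: "card C = d * s + 1"
    and v: "v \<in> attached_roots X T"
    and V: "\<And>u. u \<in> attached_roots X T - {v} \<Longrightarrow> tiling d (tree_endo T u) (V u) (tree u)"
    and W\<^sub>0: "tiling d (tree_endo T (T v)) W\<^sub>0 (insert (T v) (tree v))"
begin

definition "c = T v"
definition "W\<^sub>1 = (\<Union>u\<in>attached_roots X T - {v}. V u)"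
definition "Y = C \<union> tree v"

lemma c_cycle: "c \<in> C"
  using v by (simp add: c_def attached_roots_def)

lemma finite_tree: "finite (tree u)"
  using finite_X by (simp add: attached_tree_def)

lemma finite_C: "finite C"
  using finite_X by (simp add: cycle_nodes_def)

lemma tiling_W1: "tiling d T W\<^sub>1 (X - Y)"
proof -
  have "disjoint_family_on tree (attached_roots X T - {v})"
    using trees_disjoint by (auto simp: disjoint_family_on_def)
  then have "tiling d T W\<^sub>1 (\<Union>u\<in>attached_roots X T - {v}. tree u)"
    unfolding W\<^sub>1_def using tiling_tree_endo[OF V] by (intro tiling_UN)
  moreover have "(\<Union>u\<in>attached_roots X T - {v}. tree u) = X - Y"
    using union_trees trees_disjoint[OF v] c_cycle v unfolding Y_def by blast
  ultimately show ?thesis by simp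
qed

lemma T_tree_v: "T \<in> tree v \<rightarrow> insert c (tree v)"
  using T_tree by (auto simp: c_def)

lemma label_sum_eq_1:
  fixes z :: "'b::field"
  assumes z: "primitive_root_of_unity d z"
  shows "label_sum d z X T = 1"
proof -
  let ?N = "insert c (tree v)"
  have zd: "z ^ d = 1" using z by (simp add: primitive_root_of_unity_def)
  have NX: "?N \<subseteq> X" using c_cycle by (auto simp: attached_tree_def cycle_nodes_def)
  have YX: "Y \<subseteq> X" by (auto simp: Y_def attached_tree_def cycle_nodes_def)
  have TY: "T \<in> Y \<rightarrow> Y"
  proof
    fix x assume "x \<in> Y"
    then have "T x \<in> C \<or> T x \<in> insert c (tree v)"
      using funcset_mem[OF T_cycle] funcset_mem[OF T_tree_v] by (auto simp: Y_def)
    then show "T x \<in> Y" using c_cycle by (auto simp: Y_def)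
  qed
  \<comment> \<open>\<open>dist_to c\<close> fails to descend only at \<open>c\<close>, which
    belongs to \<open>Y\<close>.\<close>
  have "label_sum d z X T = label_sum d z Y T"
    using dist_to_less[OF _ _ c_cycle] c_cycle
    by (intro label_sum_remove_tiling[OF z finite_X T_closed YX TY tiling_W1, of "dist_to c"])
      (auto simp: Y_def)
  also have "\<dots> = label_sum d z ?N (tree_endo T c)"
    unfolding Y_def
  proof (rule label_sum_collapse_cycle)
    show "C \<inter> tree v = {}" using tree_cycle_disjoint[OF v] by blast
    show "z ^ card C = z" by (simp add: card_cycle power_mult zd)
    show "\<exists>i. (T ^^ i) x = c" if "x \<in> C" for x
      using that reach_cycle_node[OF _ c_cycle] by (simp add: cycle_nodes_def)
    show "\<exists>i. (T ^^ i) c = x" if "x \<in> C" for x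
      using that reach_cycle_node[of c] c_cycle by (simp add: cycle_nodes_def)
  qed (use finite_C finite_tree c_cycle T_cycle T_tree_v in auto)
  \<comment> \<open>Here \<open>c\<close> is a fixed point, so the distance to \<open>c\<close> may
    serve as height on the whole tree, and no node is left.\<close>
  also have "\<dots> = label_sum d z {} (tree_endo T c)"
  proof (rule label_sum_remove_tiling[OF z])
    show "tree_endo T c \<in> ?N \<rightarrow> ?N" using T_tree_v by (auto simp: tree_endo_def Pi_iff)
    show "tiling d (tree_endo T c) W\<^sub>0 (?N - {})" using W\<^sub>0 by (simp add: c_def)
    show "dist_to c (tree_endo T c x) < dist_to c x" if "x \<in> ?N - {}" "tree_endo T c x \<noteq> x" for x
      using that NX dist_to_less[OF _ _ c_cycle] by (auto simp: tree_endo_def split: if_splits)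
  qed (use finite_tree in auto)
  finally show ?thesis by simp
qed

text \<open>Existence: the other trees, the last tree with \<open>c\<close>, and the
  \<open>d * s\<close> other cycle nodes are tiled separately. Uniqueness:
  \<open>tiling_unique\<close>, with the distance to the cycle predecessor of \<open>c\<close> as
  height.\<close>

lemma card_splittings: "card {W. splitting d X T W} = 1"
proof (cases "d = 1")
  case True
  then show ?thesis by (simp add: splitting_1_iff[OF finite_X] del: One_nat_def)
next
  case False
  then have d1: "1 < d" using d by simp
  let ?N = "insert c (tree v)"
  \<comment> \<open>The predecessor of \<open>c\<close> on the cycle; for \<open>s = 0\<close> it is
    \<open>c\<close> itself.\<close>
  define e where "e = (T ^^ (d * s)) c"
  have e: "e \<in> C" unfolding e_def by (rule funpow_cycle[OF c_cycle])
  have Te: "T e = c" using cycle_param(2)[OF c_cycle] by (simp add: e_def card_cycle)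
  have NC: "?N \<inter> C = {c}" using tree_cycle_disjoint[OF v] c_cycle by blast
  define W\<^sub>2 where "W\<^sub>2 = (\<lambda>j. (T ^^ (d * j + 1)) c) ` {..<s}"
  have bij: "bij_betw (\<lambda>i. (T ^^ i) c) {..d * s} C"
    using cycle_param(1)[OF c_cycle] by (simp add: card_cycle lessThan_Suc_atMost)
  have "{..d * s} = insert 0 {1..d * s}" by auto
  then have "insert c ((\<lambda>i. (T ^^ i) c) ` {1..d * s}) = C"
    using bij by (simp add: bij_betw_def)
  moreover have "c \<notin> (\<lambda>i. (T ^^ i) c) ` {1..d * s}"
  proof
    assume "c \<in> (\<lambda>i. (T ^^ i) c) ` {1..d * s}"
    then obtain i where i: "i \<in> {1..d * s}" "c = (T ^^ i) c" by blast
    then show False using inj_onD[OF bij_betw_imp_inj_on[OF bij], of 0 i] by simp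
  qed
  ultimately have "(\<lambda>i. (T ^^ i) c) ` {1..d * s} = C - {c}" by blast
  moreover have "inj_on (\<lambda>i. (T ^^ i) c) {1..d * s}"
    using bij by (auto simp: bij_betw_def intro: inj_on_subset)
  ultimately have W2: "tiling d T W\<^sub>2 (C - {c})"
    unfolding W\<^sub>2_def using tiling_path[of T c d s] by simp
  have W0: "tiling d T W\<^sub>0 ?N"
    using tiling_tree_endo[OF W\<^sub>0] by (simp add: c_def)
  define W where "W = W\<^sub>1 \<union> W\<^sub>0 \<union> W\<^sub>2"
  have "tiling d T W ((X - Y) \<union> ?N \<union> (C - {c}))"
    unfolding W_def
    using NC c_cycle by (intro tiling_Un tiling_W1 W0 W2) (auto simp: Y_def)
  moreover have "(X - Y) \<union> ?N \<union> (C - {c}) = X"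
    using c_cycle by (auto simp: Y_def attached_tree_def cycle_nodes_def)
  ultimately have W: "tiling d T W X" by simp
  obtain w\<^sub>0 l where w0: "w\<^sub>0 \<in> W\<^sub>0" "l < d" "c = (T ^^ l) w\<^sub>0"
    using tiling_eq[OF W0] by blast
  have w0W: "w\<^sub>0 \<in> W" using w0 by (simp add: W_def)
  \<comment> \<open>A tile of \<open>W\<^sub>0\<close> starting at \<open>c\<close> would stay at
    the fixed point \<open>c\<close> of \<open>tree_endo T c\<close>, which \<open>1 < d\<close>
    excludes.\<close>
  have "c \<notin> W"
  proof
    assume "c \<in> W"
    then have "c = w\<^sub>0" using tiling_eqD(1)[OF W _ w0W d w0(2)] w0(3) by simp
    then show False
      using tiling_eqD(2)[OF W\<^sub>0, of c c 0 1] w0(1) d1 by (simp add: tree_endo_def c_def)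
  qed
  \<comment> \<open>No jump from start to start uses the edge from \<open>e\<close> to
    \<open>c\<close>. If it ended with this edge, \<open>c\<close> would be a start. Otherwise
    \<open>c\<close> and \<open>e\<close> lie in the tile of \<open>w\<^sub>0\<close>, hence in
    \<open>?N\<close>, which forces \<open>e = c\<close> and a repeated node.\<close>
  have avoid: "(T ^^ i) w \<noteq> e" if w: "w \<in> W" "(T ^^ d) w \<in> W" and i: "i < d" for w i
  proof
    assume eq: "(T ^^ i) w = e"
    then have c: "(T ^^ Suc i) w = c" using Te by simp
    then have "Suc i \<noteq> d" using w \<open>c \<notin> W\<close> by auto
    then have Si: "Suc i < d" using i by simp
    then have "w = w\<^sub>0" using tiling_eqD(1)[OF W w(1) w0W _ w0(2)] c w0(3) by simp
    then have "e \<in> ?N" using tiling_mem[OF W0 w0(1) i] eq by simp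
    then have "e = c" using e NC by blast
    then show False using tiling_eqD(2)[OF W w(1) w(1) Si i] c eq by simp
  qed
  have "dist_to e ((T ^^ d) w) < dist_to e w" if "w \<in> W" "(T ^^ d) w \<in> W" for w
    using that tiling_subset[OF W d] by (intro dist_to_funpow_less[OF _ e d] avoid) auto
  then have "W' = W" if "tiling d T W' X" for W'
    using tiling_unique[OF d finite_X W that, of "dist_to e"] by simp
  then have "splitting d X T W' \<longleftrightarrow> W' = W" for W'
    using W unfolding splitting_iff_tiling[OF finite_X d] by metis
  then have "{W. splitting d X T W} = {W}" by simp
  then show ?thesis by simp
qed

end

theorem theorem4p5:
  fixes d n k s :: nat and \<zeta> :: complex
    and T :: "nat \<Rightarrow> nat" and r :: "nat \<Rightarrow> nat"
  assumes "d > 0" and "n > 0" and "k > 0" and "d dvd n"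
    and "primitive_root_of_unity d \<zeta>"
    and "T \<in> {1..n} \<rightarrow> {1..n}"
    and "connected_endo {1..n} T"
    and "card (cycle_nodes {1..n} T) = d * s + 1"
    and "bij_betw r {1..k} (attached_roots {1..n} T)"
    and "\<And>i. i \<in> {1..k-1} \<Longrightarrow> tree_has_splitting d (attached_tree {1..n} T (r i)) T (r i)"
    and "tree_has_splitting d (insert (T (r k)) (attached_tree {1..n} T (r k))) T (T (r k))"
  shows "of_nat (\<sigma> d {1..n} T) = flag_gf d {1..n} T (\<lambda>i. \<zeta> ^ i)"
proof -
  let ?X = "{1..n}"
  have has_tiling: "\<exists>W. tiling d (tree_endo T u) W N"
    if "tree_has_splitting d N T u" "N \<subseteq> ?X" for N u
    using that splitting_iff_tiling[OF finite_subset[OF that(2)] \<open>d > 0\<close>]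
    by (simp add: tree_has_splitting_def)
  have root: "r k \<in> attached_roots ?X T"
    using bij_betwE[OF assms(9)] assms(3) by simp
  have tree: "attached_tree ?X T u \<subseteq> ?X" for u
    unfolding attached_tree_def by (rule Collect_subset)
  have "\<exists>W. tiling d (tree_endo T u) W (attached_tree ?X T u)"
    if u: "u \<in> attached_roots ?X T - {r k}" for u
  proof -
    obtain i where i: "i \<in> {1..k}" "u = r i" using u bij_betw_imp_surj_on[OF assms(9)] by blast
    then have "i \<noteq> k" using u by blast
    then have "i \<in> {1..k-1}" using i by auto
    then show ?thesis unfolding i(2) by (intro has_tiling assms(10) tree)
  qed
  then have "\<forall>u\<in>attached_roots ?X T - {r k}. \<exists>W. tiling d (tree_endo T u) W (attached_tree ?X T u)"
    by (intro ballI)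
  then obtain V where V: "\<forall>u\<in>attached_roots ?X T - {r k}.
      tiling d (tree_endo T u) (V u) (attached_tree ?X T u)"
    by (elim bchoice[THEN exE])
  have "T (r k) \<in> ?X"
    using root assms(6) by (simp add: attached_roots_def Pi_iff)
  then obtain W\<^sub>0 where W0: "tiling d (tree_endo T (T (r k))) W\<^sub>0
      (insert (T (r k)) (attached_tree ?X T (r k)))"
    using has_tiling[OF assms(11)] tree by (meson insert_subsetI)
  interpret unicyclic_tiled ?X T d s "r k" V W\<^sub>0
  proof
    show "tiling d (tree_endo T u) (V u) (attached_tree ?X T u)"
      if "u \<in> attached_roots ?X T - {r k}" for u
      using V that by (rule bspec)
  qed (rule finite_atLeastAtMost assms root W0)+
  \<comment> \<open>Both sides are 1: there is one splitting subset, and the label sum is 1.\<close>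
  have "of_nat (\<sigma> d ?X T) = label_sum d \<zeta> ?X T"
    unfolding \<sigma>_def card_splittings label_sum_eq_1[OF assms(5)] by simp
  also have "\<dots> = flag_gf d ?X T (\<lambda>i. \<zeta> ^ i)"
    unfolding label_sum_def by (rule flag_gf_eq_sum_labelings[OF finite_atLeastAtMost assms(6), symmetric])
  finally show ?thesis .
qed

end
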